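(* Let $(X,\tau_1,\tau_2)$ be a $p$-normal bitopological space such that $X=\bigcup_{k=1}^\infty F_k$ for a sequence $F_1,F_2,\ldots$ of $p$-closed subsets of $X$, where for each $k\ge 1$ the set $F_k$ (with its bitopological subspace structure) is $p$-WS-supernormal in $X$ and $p\text{-}\mathrm{Ind}\,F_k=0$. Then $p\text{-}\mathrm{Ind}\,X=0$.
   Context: A bitopological space $(X,\tau_1,\tau_2)$ is a set $X$ with two topologies. Always $i,j\in\{1,2\}$, $i\ne j$. "$i$-open", "$i$-closed" refer to $\tau_i$; $\mathrm{co}\,\tau_i$ is the family of $\tau_i$-closed sets. A subset $Y\subset X$ is regarded as a bitopological subspace $(Y,\tau_1',\tau_2')$ with the induced topologies. $p$-closed: a set $B\subset X$ is $p$-closed if $B=B_1\cap B_2$ with $B_1\in\mathrm{co}\,\tau_1$, $B_2\in\mathrm{co}\,\tau_2$. $p$-normal: for every pair of disjoint sets $A,B$ in $X$ with $A$ 1-closed and $B$ 2-closed there are a 2-open set $U$ and a 1-open set $V$ such that $A\subset U$, $B\subset V$, $U\cap V=\varnothing$. A subspace $(Y,\tau_1',\tau_2')$ of $(X,\tau_1,\tau_2)$ is $(i,j)$-WS-supernormal in $X$ if for each pair of disjoint sets $A\in\mathrm{co}\,\tau_i'$, $B\in\mathrm{co}\,\tau_j$ there are disjoint sets $U\in\tau_j'$, $V\in\tau_i$ such that $A\subset U$ and $B\subset V$. It is $p$-WS-supernormal in $X$ if it is both $(1,2)$- and $(2,1)$-WS-supernormal in $X$. $p\text{-}\mathrm{Ind}\,X=0$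 means: for every 1-closed set $F$ and every 2-open $U\supset F$ there is $V\in\tau_2\cap\mathrm{co}\,\tau_1$ with $F\subset V\subset U$, and for every 2-closed set $\Phi$ and every 1-open $U\supset\Phi$ there is $V\in\tau_1\cap\mathrm{co}\,\tau_2$ with $\Phi\subset V\subset U$. *)

theory Defs
  imports "HOL-Analysis.Analysis"
begin

text \<open>
  A bitopological space \<open>(X, \<tau>\<^sub>1, \<tau>\<^sub>2)\<close> is a pair of topologies with the common
  carrier \<open>X = topspace T1 = topspace T2\<close>.  The induced structure on \<open>Y \<subseteq> X\<close> is
  \<open>(subtopology T1 Y, subtopology T2 Y)\<close>.  Notions indexed by \<open>(i, j)\<close> take the two
  topologies \<open>Ti\<close>, \<open>Tj\<close> as arguments in that order, so the \<open>(2, 1)\<close>-version is obtained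
  by swapping them.
\<close>

definition bitopological_space :: "'a topology \<Rightarrow> 'a topology \<Rightarrow> bool" where
  "bitopological_space T1 T2 \<longleftrightarrow> topspace T1 = topspace T2"

definition p_closed :: "'a topology \<Rightarrow> 'a topology \<Rightarrow> 'a set \<Rightarrow> bool" where
  "p_closed T1 T2 B \<longleftrightarrow> (\<exists>B1 B2. closedin T1 B1 \<and> closedin T2 B2 \<and> B = B1 \<inter> B2)"

definition p_normal :: "'a topology \<Rightarrow> 'a topology \<Rightarrow> bool" where
  "p_normal T1 T2 \<longleftrightarrow>
     (\<forall>A B. closedin T1 A \<and> closedin T2 B \<and> A \<inter> B = {} \<longrightarrow>
        (\<exists>U V. openin T2 U \<and> openin T1 V \<and> A \<subseteq> U \<and> B \<subseteq> V \<and> U \<inter> V = {}))"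

text \<open>
  The set \<open>B\<close> and its neighbourhood \<open>V\<close> live in the ambient space, whereas \<open>A\<close> and its
  neighbourhood \<open>U\<close> live in the subspace \<open>Y\<close>.
\<close>

definition WS_supernormal_in :: "'a topology \<Rightarrow> 'a topology \<Rightarrow> 'a set \<Rightarrow> bool" where
  "WS_supernormal_in Ti Tj Y \<longleftrightarrow>
     (\<forall>A B. closedin (subtopology Ti Y) A \<and> closedin Tj B \<and> A \<inter> B = {} \<longrightarrow>
        (\<exists>U V. openin (subtopology Tj Y) U \<and> openin Ti V \<and> U \<inter> V = {} \<and> A \<subseteq> U \<and> B \<subseteq> V))"

definition p_WS_supernormal_in :: "'a topology \<Rightarrow> 'a topology \<Rightarrow> 'a set \<Rightarrow> bool" where
  "p_WS_supernormal_in T1 T2 Y \<longleftrightarrow> WS_supernormal_in T1 T2 Y \<and> WS_supernormal_in T2 T1 Y"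

text \<open>
  The condition \<open>p-Ind X = 0\<close>.  The empty space satisfies it.
\<close>

definition p_Ind_eq_0 :: "'a topology \<Rightarrow> 'a topology \<Rightarrow> bool" where
  "p_Ind_eq_0 T1 T2 \<longleftrightarrow>
     (\<forall>F U. closedin T1 F \<and> openin T2 U \<and> F \<subseteq> U \<longrightarrow>
        (\<exists>V. openin T2 V \<and> closedin T1 V \<and> F \<subseteq> V \<and> V \<subseteq> U)) \<and>
     (\<forall>\<Phi> U. closedin T2 \<Phi> \<and> openin T1 U \<and> \<Phi> \<subseteq> U \<longrightarrow>
        (\<exists>V. openin T1 V \<and> closedin T2 V \<and> \<Phi> \<subseteq> V \<and> V \<subseteq> U))"

end

theory Submission
  imports Defs
begin

text \<open>
  A disjoint pair consisting of a 1-closed set \<open>C\<close> and a 2-closed set \<open>D\<close> is enlarged step by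
  step: \<open>p-Ind F\<^sub>k = 0\<close> splits \<open>F\<^sub>k\<close> into \<open>E\<close> and \<open>E'\<close> along the traces of \<open>C\<close> and \<open>D\<close>;
  WS-supernormality keeps the 1-closure of \<open>E\<close> away from \<open>D\<close> and the 2-closure of \<open>E'\<close> away
  from \<open>C\<close>, and p-closedness of \<open>F\<^sub>k\<close> keeps the two closures apart.  By p-normality the enlarged
  pair has neighbourhoods whose closures are again disjoint.  In the limit the 2-open and 1-open
  neighbourhoods partition the space.
\<close>

text \<open>p-normality is applied twice. The 1-closure \<open>C'\<close> of the first 2-open
  neighbourhood of \<open>C\<close> still misses \<open>D\<close>, since a 1-open neighbourhood of
  \<open>D\<close> separates them. Separating \<open>C'\<close> from \<open>D\<close> in turn leaves
  room for the 2-closure of a 1-open neighbourhood of \<open>D\<close>.\<close>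

lemma p_normal_closed_neighbourhoods:
  assumes top: "topspace T1 = topspace T2" and norm: "p_normal T1 T2"
    and C: "closedin T1 C" and D: "closedin T2 D" and "C \<inter> D = {}"
  obtains C' D' where "closedin T1 C'" "closedin T2 D'" "C' \<inter> D' = {}"
    "C \<subseteq> T2 interior_of C'" "D \<subseteq> T1 interior_of D'"
proof -
  obtain U V where U: "openin T2 U" "C \<subseteq> U" and V: "openin T1 V" "D \<subseteq> V" and "U \<inter> V = {}"
    using norm C D \<open>C \<inter> D = {}\<close> unfolding p_normal_def by meson
  define C' where "C' = T1 closure_of U"
  have "V \<inter> C' = {}"
    using \<open>U \<inter> V = {}\<close> V(1) by (simp add: C'_def openin_Int_closure_of_eq_empty Int_commute)
  then have "C' \<inter> D = {}" using V(2) by blast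
  have C': "closedin T1 C'" by (simp add: C'_def)
  obtain P W where P: "openin T2 P" "C' \<subseteq> P" and W: "openin T1 W" "D \<subseteq> W" and "P \<inter> W = {}"
    using norm C' D \<open>C' \<inter> D = {}\<close> unfolding p_normal_def by meson
  define D' where "D' = T2 closure_of W"
  have "P \<inter> D' = {}"
    using \<open>P \<inter> W = {}\<close> P(1) by (simp add: D'_def openin_Int_closure_of_eq_empty)
  then have "C' \<inter> D' = {}" using P(2) by blast
  moreover have "U \<subseteq> C'"
    using openin_subset[OF U(1)] top by (simp add: C'_def closure_of_subset)
  then have "C \<subseteq> T2 interior_of C'"
    using U interior_of_maximal by blast
  moreover have "W \<subseteq> D'"
    using openin_subset[OF W(1)] top by (simp add: D'_def closure_of_subset)
  then have "D \<subseteq> T1 interior_of D'"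
    using W interior_of_maximal by blast
  moreover have "closedin T2 D'" by (simp add: D'_def)
  ultimately show thesis using that C' by blast
qed

text \<open>The neighbourhood \<open>V\<close> of \<open>B\<close> is open in the whole space, so as
  soon as it misses \<open>A\<close> it misses the closure of \<open>A\<close> taken there.\<close>

lemma WS_supernormal_in_closure_disjoint:
  assumes "WS_supernormal_in Ti Tj Y" "closedin (subtopology Ti Y) A" "closedin Tj B" "A \<inter> B = {}"
  shows "Ti closure_of A \<inter> B = {}"
proof -
  obtain U V where "openin Ti V" "U \<inter> V = {}" "A \<subseteq> U" "B \<subseteq> V"
    using assms unfolding WS_supernormal_in_def by meson
  then have "V \<inter> A = {}" by blast
  then have "V \<inter> Ti closure_of A = {}"
    using \<open>openin Ti V\<close> by (simp add: openin_Int_closure_of_eq_empty)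
  then show ?thesis using \<open>B \<subseteq> V\<close> by blast
qed

text \<open>With \<open>Y = Y1 \<inter> Y2\<close>, one closure stays in \<open>Y1\<close> and the
  other in \<open>Y2\<close>, so a common point lies in \<open>Y\<close>. Inside \<open>Y\<close>
  the closures add nothing to the relatively closed sets \<open>A\<close> and
  \<open>B\<close>.\<close>

lemma p_closed_closures_disjoint:
  assumes "p_closed T1 T2 Y"
    and A: "closedin (subtopology T1 Y) A" and B: "closedin (subtopology T2 Y) B"
    and "A \<inter> B = {}"
  shows "T1 closure_of A \<inter> T2 closure_of B = {}"
proof -
  obtain Y1 Y2 where Y: "closedin T1 Y1" "closedin T2 Y2" "Y = Y1 \<inter> Y2"
    using assms(1) unfolding p_closed_def by blast
  have "A \<subseteq> Y" "B \<subseteq> Y"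
    using closedin_subset[OF A] closedin_subset[OF B] by auto
  then have "T1 closure_of A \<subseteq> Y1" "T2 closure_of B \<subseteq> Y2"
    using closure_of_minimal[OF _ Y(1)] closure_of_minimal[OF _ Y(2)] Y(3) by auto
  moreover have "Y \<inter> T1 closure_of A = A" "Y \<inter> T2 closure_of B = B"
    using A B \<open>A \<subseteq> Y\<close> \<open>B \<subseteq> Y\<close>
    by (metis closure_of_closedin closure_of_subtopology_subset inf.absorb_iff2 closure_of_subtopology)+
  ultimately show ?thesis using Y(3) \<open>A \<inter> B = {}\<close> by blast
qed

lemma p_Ind_eq_0_separation_step:
  assumes top: "topspace T1 = topspace T2" and norm: "p_normal T1 T2"
    and pcl: "p_closed T1 T2 Y" and ws: "p_WS_supernormal_in T1 T2 Y"
    and ind: "p_Ind_eq_0 (subtopology T1 Y) (subtopology T2 Y)"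
    and C: "closedin T1 C" and D: "closedin T2 D" and "C \<inter> D = {}"
  obtains C' D' where "closedin T1 C'" "closedin T2 D'" "C' \<inter> D' = {}"
    "C \<subseteq> T2 interior_of C'" "D \<subseteq> T1 interior_of D'"
    "Y \<subseteq> T2 interior_of C' \<union> T1 interior_of D'"
proof -
  have Y1: "Y \<subseteq> topspace T1"
    using pcl unfolding p_closed_def by (auto dest: closedin_subset)
  then have Y2: "Y \<subseteq> topspace T2" using top by simp
  have "closedin (subtopology T1 Y) (Y \<inter> C)"
    using C by (simp add: closedin_subtopology_Int_closed)
  moreover have "openin (subtopology T2 Y) (Y - D)"
  proof -
    have "Y - D = Y \<inter> (topspace T2 - D)" using Y2 by blast
    then show ?thesis using D by (simp add: openin_subtopology_Int2 openin_diff)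
  qed
  moreover have "Y \<inter> C \<subseteq> Y - D" using \<open>C \<inter> D = {}\<close> by blast
  \<comment> \<open>\<open>E\<close> is 1-closed and 2-open in \<open>Y\<close>, so
    \<open>Y - E\<close> is 2-closed in \<open>Y\<close>, and the two pieces play symmetric
    roles.\<close>
  ultimately obtain E where E2: "openin (subtopology T2 Y) E"
    and E: "closedin (subtopology T1 Y) E" and "Y \<inter> C \<subseteq> E" "E \<subseteq> Y - D"
    using ind unfolding p_Ind_eq_0_def by meson
  have "topspace (subtopology T2 Y) = Y" using Y2 by (simp add: inf_absorb2)
  then have E': "closedin (subtopology T2 Y) (Y - E)"
    using E2 by (metis closedin_diff closedin_topspace)
  \<comment> \<open>\<open>E\<close> and \<open>Y - E\<close> are closed only relative to
    \<open>Y\<close>. Their closures in the whole space are used, so that p-normality can be applied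
    to the enlarged pair.\<close>
  have "T1 closure_of E \<inter> D = {}"
    using WS_supernormal_in_closure_disjoint[OF _ E D] ws \<open>E \<subseteq> Y - D\<close>
    unfolding p_WS_supernormal_in_def by blast
  moreover have "T2 closure_of (Y - E) \<inter> C = {}"
    using WS_supernormal_in_closure_disjoint[OF _ E' C] ws \<open>Y \<inter> C \<subseteq> E\<close>
    unfolding p_WS_supernormal_in_def by blast
  moreover have "T1 closure_of E \<inter> T2 closure_of (Y - E) = {}"
    using p_closed_closures_disjoint[OF pcl E E'] by blast
  ultimately have "(C \<union> T1 closure_of E) \<inter> (D \<union> T2 closure_of (Y - E)) = {}"
    using \<open>C \<inter> D = {}\<close> by blast
  moreover have "closedin T1 (C \<union> T1 closure_of E)" "closedin T2 (D \<union> T2 closure_of (Y - E))"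
    using C D by auto
  ultimately obtain C' D' where C': "closedin T1 C'" "closedin T2 D'" "C' \<inter> D' = {}"
    "C \<union> T1 closure_of E \<subseteq> T2 interior_of C'"
    "D \<union> T2 closure_of (Y - E) \<subseteq> T1 interior_of D'"
    using p_normal_closed_neighbourhoods[OF top norm] by metis
  have "E \<subseteq> T1 closure_of E" "Y - E \<subseteq> T2 closure_of (Y - E)"
    using \<open>E \<subseteq> Y - D\<close> Y1 Y2 by (auto intro!: closure_of_subset)
  then have "Y \<subseteq> T2 interior_of C' \<union> T1 interior_of D'"
    using C'(4,5) by blast
  then show thesis using that C' by blast
qed

lemma p_normal_countable_union_separation:
  fixes Y :: "nat \<Rightarrow> 'a set"
  assumes top: "topspace T1 = topspace T2" and norm: "p_normal T1 T2"
    and cover: "topspace T1 = (\<Union>k. Y k)"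
    and pcl: "\<And>k. p_closed T1 T2 (Y k)" and ws: "\<And>k. p_WS_supernormal_in T1 T2 (Y k)"
    and ind: "\<And>k. p_Ind_eq_0 (subtopology T1 (Y k)) (subtopology T2 (Y k))"
    and A: "closedin T1 A" and B: "closedin T2 B" and "A \<inter> B = {}"
  obtains V W where "openin T2 V" "openin T1 W" "A \<subseteq> V" "B \<subseteq> W" "V \<inter> W = {}"
    "V \<union> W = topspace T1"
proof -
  \<comment> \<open>The state \<open>S\<close> is the current pair of closed sets. The clause for
    \<open>n = 0\<close> pins the starting pair and is vacuous later; \<open>Q n\<close> says that
    the passage to stage \<open>n + 1\<close> absorbs \<open>Y n\<close>.\<close>
  define P where "P n S \<longleftrightarrow> closedin T1 (fst S) \<and> closedin T2 (snd S) \<and> fst S \<inter> snd S = {} \<and>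
    (n = 0 \<longrightarrow> S = (A, B))" for n :: nat and S
  define Q where "Q n S S' \<longleftrightarrow> fst S \<subseteq> T2 interior_of fst S' \<and> snd S \<subseteq> T1 interior_of snd S' \<and>
    Y n \<subseteq> T2 interior_of fst S' \<union> T1 interior_of snd S'" for n :: nat and S S'
  have "\<exists>S. \<forall>n. P n (S n) \<and> Q n (S n) (S (Suc n))"
  proof (rule dependent_nat_choice)
    show "\<exists>S. P 0 S" using A B \<open>A \<inter> B = {}\<close> by (auto simp: P_def)
    fix S n assume "P n S"
    then have "closedin T1 (fst S)" "closedin T2 (snd S)" "fst S \<inter> snd S = {}"
      by (simp_all add: P_def)
    then obtain C' D' where "closedin T1 C'" "closedin T2 D'" "C' \<inter> D' = {}"
      "fst S \<subseteq> T2 interior_of C'" "snd S \<subseteq> T1 interior_of D'"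
      "Y n \<subseteq> T2 interior_of C' \<union> T1 interior_of D'"
      by (rule p_Ind_eq_0_separation_step[OF top norm pcl ws ind])
    then have "P (Suc n) (C', D') \<and> Q n S (C', D')" by (simp add: P_def Q_def)
    then show "\<exists>S'. P (Suc n) S' \<and> Q n S S'" by blast
  qed
  then obtain S where P: "\<And>n. P n (S n)" and Q: "\<And>n. Q n (S n) (S (Suc n))" by blast
  define C D where "C n = fst (S n)" and "D n = snd (S n)" for n
  have disj: "C n \<inter> D n = {}" for n using P[of n] by (simp add: P_def C_def D_def)
  have zero: "C 0 = A" "D 0 = B" using P[of 0] by (simp_all add: P_def C_def D_def)
  have step: "C n \<subseteq> T2 interior_of C (Suc n)" "D n \<subseteq> T1 interior_of D (Suc n)"
    "Y n \<subseteq> T2 interior_of C (Suc n) \<union> T1 interior_of D (Suc n)" for n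
    using Q[of n] by (simp_all add: Q_def C_def D_def)
  have "C n \<subseteq> C (Suc n)" "D n \<subseteq> D (Suc n)" for n
    by (rule subset_trans[OF step(1) interior_of_subset] subset_trans[OF step(2) interior_of_subset])+
  then have mono: "C m \<subseteq> C n" "D m \<subseteq> D n" if "m \<le> n" for m n
    using lift_Suc_mono_le[of C, OF _ that] lift_Suc_mono_le[of D, OF _ that] by blast+
  \<comment> \<open>Unions of the sets \<open>C n\<close> need be neither open nor closed, but the
    unions of their interiors are open. Nothing is lost, since each \<open>C n\<close> lies in the
    interior of \<open>C (Suc n)\<close>, and likewise for \<open>D\<close>.\<close>
  define V W where "V = (\<Union>n. T2 interior_of C n)" and "W = (\<Union>n. T1 interior_of D n)"
  show thesis
  proof
    show "openin T2 V" "openin T1 W" by (auto simp: V_def W_def)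
    show "A \<subseteq> V" "B \<subseteq> W" using step(1,2)[of 0] unfolding V_def W_def zero by blast+
    \<comment> \<open>Sets from different stages are compared at the later stage
      \<open>max m n\<close>.\<close>
    have "C m \<inter> D n = {}" for m n
      using mono(1)[of m "max m n"] mono(2)[of n "max m n"] disj[of "max m n"] by force
    moreover have "V \<subseteq> (\<Union>n. C n)" "W \<subseteq> (\<Union>n. D n)"
      unfolding V_def W_def by (intro UN_mono order_refl interior_of_subset)+
    ultimately show "V \<inter> W = {}" by blast
    have "topspace T1 \<subseteq> V \<union> W" using step(3) unfolding cover V_def W_def by blast
    then show "V \<union> W = topspace T1"
      using openin_subset[OF \<open>openin T2 V\<close>] openin_subset[OF \<open>openin T1 W\<close>] top by blast
  qed
qed

theorem corollary2p24:
  fixes T1 T2 :: "'a topology" and F :: "nat \<Rightarrow> 'a set"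
  assumes "bitopological_space T1 T2"
    and "p_normal T1 T2"
    and "topspace T1 = (\<Union>k\<in>{1..}. F k)"
    and "\<And>k. k \<ge> 1 \<Longrightarrow> p_closed T1 T2 (F k)"
    and "\<And>k. k \<ge> 1 \<Longrightarrow> p_WS_supernormal_in T1 T2 (F k)"
    and "\<And>k. k \<ge> 1 \<Longrightarrow> p_Ind_eq_0 (subtopology T1 (F k)) (subtopology T2 (F k))"
  shows "p_Ind_eq_0 T1 T2"
proof -
  have top: "topspace T1 = topspace T2"
    using assms(1) by (simp add: bitopological_space_def)
  have "k \<in> range Suc" if "k \<ge> 1" for k
    using that by (cases k) auto
  \<comment> \<open>The given sequence starts at 1, the recursion at 0.\<close>
  then have "{1..} = range Suc" by auto
  then have cover: "topspace T1 = (\<Union>k. F (Suc k))" using assms(3) by auto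
  have separation: "\<exists>V W. openin T2 V \<and> openin T1 W \<and> A \<subseteq> V \<and> B \<subseteq> W \<and> V \<inter> W = {} \<and>
      V \<union> W = topspace T1" if "closedin T1 A" "closedin T2 B" "A \<inter> B = {}" for A B
  proof -
    have "p_closed T1 T2 (F (Suc k))" "p_WS_supernormal_in T1 T2 (F (Suc k))"
      "p_Ind_eq_0 (subtopology T1 (F (Suc k))) (subtopology T2 (F (Suc k)))" for k
      by (simp_all add: assms(4-6))
    from p_normal_countable_union_separation[OF top assms(2) cover this that]
    show ?thesis by metis
  qed
  show ?thesis
    unfolding p_Ind_eq_0_def
  proof (intro conjI allI impI; elim conjE)
    fix A U assume A: "closedin T1 A" and U: "openin T2 U" and "A \<subseteq> U"
    \<comment> \<open>Separating \<open>A\<close> from the complement of \<open>U\<close> gives a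
      partition of the space: \<open>V\<close> is the complement of a 1-open set, hence 1-closed,
      and it avoids the complement of \<open>U\<close>.\<close>
    then have "closedin T2 (topspace T2 - U)" "A \<inter> (topspace T2 - U) = {}" by auto
    with A obtain V W where V: "openin T2 V" "openin T1 W" "A \<subseteq> V" "topspace T2 - U \<subseteq> W"
      "V \<inter> W = {}" "V \<union> W = topspace T1"
      using separation by meson
    then have "V = topspace T1 - W" by blast
    then have "closedin T1 V" using V(2) by blast
    moreover have "V \<subseteq> U" using V top by blast
    ultimately show "\<exists>V. openin T2 V \<and> closedin T1 V \<and> A \<subseteq> V \<and> V \<subseteq> U" using V by blast
  next
    fix B U assume B: "closedin T2 B" and U: "openin T1 U" and "B \<subseteq> U"
    \<comment> \<open>Here the complement of \<open>U\<close> is the 1-closed member of the pair,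
      and the set sought is the 1-open half \<open>W\<close>.\<close>
    then have "closedin T1 (topspace T1 - U)" "(topspace T1 - U) \<inter> B = {}" by auto
    with B obtain V W where V: "openin T2 V" "openin T1 W" "topspace T1 - U \<subseteq> V" "B \<subseteq> W"
      "V \<inter> W = {}" "V \<union> W = topspace T1"
      using separation by meson
    then have "W = topspace T2 - V" using top by blast
    then have "closedin T2 W" using V(1) by blast
    moreover have "W \<subseteq> U" using V by blast
    ultimately show "\<exists>V. openin T1 V \<and> closedin T2 V \<and> B \<subseteq> V \<and> V \<subseteq> U" using V by blast
  qed
qed

end
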